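(* Let $G$ be a finite connected bridgeless planar graph, embedded in the plane, and let $C_1$ and $C_2$ be two cycles in $G$ with the same signature, so that for each finite face $F$ of $G$ the cycles $C_1$ and $C_2$ traverse the same number of edges of $F$. Then $C_1$ and $C_2$ traverse the same number of edges of the exterior face of $G$ as well.
   Context: For a planar graph $G$ embedded in the plane and a cycle $C$ in $G$, the signature of $C$ in $G$ is the function assigning to each finite (i.e. bounded) face $F$ of $G$ the number of edges of $F$ (edges on the boundary of $F$) which belong to $C$. The exterior face is the unbounded face of $G$; it receives no number in a signature. *)

theory Defs
  imports "HOL-Analysis.Analysis"
begin

section \<open>Undirected multigraphs\<close>

text \<open>Loops and parallel edges are permitted: an edge has a set of one (loop) or two
  endpoints.  Simple graphs are the special case in which every edge has two endpoints and
  distinct edges have distinct sets of endpoints.\<close>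

record ('v, 'e) multigraph =
  verts :: "'v set"
  edges :: "'e set"
  ends  :: "'e \<Rightarrow> 'v set"

definition finite_graph :: "('v, 'e) multigraph \<Rightarrow> bool" where
  "finite_graph G \<longleftrightarrow>
     finite (verts G) \<and> finite (edges G) \<and>
     (\<forall>e\<in>edges G. ends G e \<subseteq> verts G \<and> card (ends G e) \<in> {1, 2})"

definition adjacent :: "('v, 'e) multigraph \<Rightarrow> 'v \<Rightarrow> 'v \<Rightarrow> bool" where
  "adjacent G u v \<longleftrightarrow> (\<exists>e\<in>edges G. ends G e = {u, v})"

definition joined :: "('v, 'e) multigraph \<Rightarrow> 'v \<Rightarrow> 'v \<Rightarrow> bool" where
  "joined G = (adjacent G)\<^sup>*\<^sup>*"

definition connected_graph :: "('v, 'e) multigraph \<Rightarrow> bool" where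
  "connected_graph G \<longleftrightarrow> verts G \<noteq> {} \<and> (\<forall>u\<in>verts G. \<forall>v\<in>verts G. joined G u v)"

definition delete_edge :: "('v, 'e) multigraph \<Rightarrow> 'e \<Rightarrow> ('v, 'e) multigraph" where
  "delete_edge G e = G\<lparr>edges := edges G - {e}\<rparr>"

definition bridge :: "('v, 'e) multigraph \<Rightarrow> 'e \<Rightarrow> bool" where
  "bridge G e \<longleftrightarrow>
     e \<in> edges G \<and> (\<exists>u\<in>ends G e. \<exists>v\<in>ends G e. \<not> joined (delete_edge G e) u v)"

definition bridgeless :: "('v, 'e) multigraph \<Rightarrow> bool" where
  "bridgeless G \<longleftrightarrow> (\<forall>e\<in>edges G. \<not> bridge G e)"

text \<open>A cycle visits pairwise distinct vertices \<open>vs\<close> cyclically along pairwise distinct edges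
  \<open>es\<close>; it is represented by its edge set, which determines its vertices.  Length 1 is a
  loop and length 2 a pair of parallel edges, so in a simple graph all cycles have length at
  least 3.\<close>

definition is_cycle :: "('v, 'e) multigraph \<Rightarrow> 'e set \<Rightarrow> bool" where
  "is_cycle G C \<longleftrightarrow>
     (\<exists>vs es. es \<noteq> [] \<and> length vs = length es \<and> distinct vs \<and> distinct es \<and>
        set es \<subseteq> edges G \<and>
        (\<forall>i<length es. ends G (es ! i) = {vs ! i, vs ! (Suc i mod length vs)}) \<and>
        C = set es)"

section \<open>Embeddings in the plane\<close>

text \<open>The plane is \<^typ>\<open>complex\<close>.  Vertices are drawn as distinct points, and an edge as an
  arbitrary continuous simple path between its endpoints (a simple closed one for a loop).
  An edge passes through no vertex other than its endpoints, and distinct edges meet only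
  in vertices.\<close>

definition plane_embedding ::
    "('v, 'e) multigraph \<Rightarrow> ('v \<Rightarrow> complex) \<Rightarrow> ('e \<Rightarrow> real \<Rightarrow> complex) \<Rightarrow> bool" where
  "plane_embedding G pos crv \<longleftrightarrow>
     inj_on pos (verts G) \<and>
     (\<forall>e\<in>edges G. simple_path (crv e) \<and>
        {pathstart (crv e), pathfinish (crv e)} = pos ` ends G e \<and>
        path_image (crv e) \<inter> pos ` verts G \<subseteq> pos ` ends G e) \<and>
     (\<forall>e\<in>edges G. \<forall>e'\<in>edges G. e \<noteq> e' \<longrightarrow>
        path_image (crv e) \<inter> path_image (crv e') \<subseteq> pos ` verts G)"

definition drawing ::
    "('v, 'e) multigraph \<Rightarrow> ('v \<Rightarrow> complex) \<Rightarrow> ('e \<Rightarrow> real \<Rightarrow> complex) \<Rightarrow> complex set" where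
  "drawing G pos crv = pos ` verts G \<union> (\<Union>e\<in>edges G. path_image (crv e))"

definition faces ::
    "('v, 'e) multigraph \<Rightarrow> ('v \<Rightarrow> complex) \<Rightarrow> ('e \<Rightarrow> real \<Rightarrow> complex) \<Rightarrow> complex set set" where
  "faces G pos crv = components (- drawing G pos crv)"

definition finite_faces ::
    "('v, 'e) multigraph \<Rightarrow> ('v \<Rightarrow> complex) \<Rightarrow> ('e \<Rightarrow> real \<Rightarrow> complex) \<Rightarrow> complex set set" where
  "finite_faces G pos crv = {F \<in> faces G pos crv. bounded F}"

definition exterior_face ::
    "('v, 'e) multigraph \<Rightarrow> ('v \<Rightarrow> complex) \<Rightarrow> ('e \<Rightarrow> real \<Rightarrow> complex) \<Rightarrow> complex set" where
  "exterior_face G pos crv = (THE F. F \<in> faces G pos crv \<and> \<not> bounded F)"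

lemma ex1_exterior_face:
  assumes "finite_graph G" "plane_embedding G pos crv"
  shows "\<exists>!F. F \<in> faces G pos crv \<and> \<not> bounded F"
proof -
  have "bounded (drawing G pos crv)"
    using assms unfolding drawing_def finite_graph_def plane_embedding_def
    by (auto intro!: bounded_UN intro: finite_imp_bounded bounded_simple_path_image)
  then have "bounded (- (- drawing G pos crv))"
    by simp
  then show ?thesis
    unfolding faces_def
    using cobounded_unbounded_components cobounded_unique_unbounded_components
    by (metis DIM_complex order_refl)
qed

definition face_edges ::
    "('v, 'e) multigraph \<Rightarrow> ('e \<Rightarrow> real \<Rightarrow> complex) \<Rightarrow> complex set \<Rightarrow> 'e set" where
  "face_edges G crv F = {e \<in> edges G. path_image (crv e) \<subseteq> frontier F}"

text \<open>The signature is a function on the finite faces only, hence the restriction.\<close>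

definition signature ::
    "('v, 'e) multigraph \<Rightarrow> ('v \<Rightarrow> complex) \<Rightarrow> ('e \<Rightarrow> real \<Rightarrow> complex) \<Rightarrow> 'e set
      \<Rightarrow> complex set \<Rightarrow> nat" where
  "signature G pos crv C =
     restrict (\<lambda>F. card (face_edges G crv F \<inter> C)) (finite_faces G pos crv)"

end

theory Submission
  imports Defs
begin

text \<open>Give each face the sign \<open>\<sigma>\<^sub>i = 1\<close> if it lies inside \<open>C\<^sub>i\<close> and \<open>\<sigma>\<^sub>i = -1\<close> otherwise, and count
  \<open>\<Sum>F. \<sigma>\<^sub>1 F * \<sigma>\<^sub>2 F * (number of edges of F in C\<^sub>1)\<close> edge by edge.  An edge of \<open>C\<^sub>1\<close> borders exactly
  two faces, one on either side of \<open>C\<^sub>1\<close>.  If it is not an edge of \<open>C\<^sub>2\<close>, these faces lie on the same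
  side of \<open>C\<^sub>2\<close> and their contributions cancel.  So only the edges common to \<open>C\<^sub>1\<close> and \<open>C\<^sub>2\<close>
  contribute, and the sum does not change when \<open>C\<^sub>1\<close> is replaced by \<open>C\<^sub>2\<close> in the last factor.  As all
  terms but the one of the exterior face agree, that one agrees as well.

  That an edge \<open>e\<close> of a cycle borders exactly one face on either side of the cycle follows from
  Janiszewski's theorem, applied to the cycle and to the drawing with the open edge \<open>e\<close> removed:
  their intersection is the cycle without the open edge \<open>e\<close>, which is connected.\<close>

locale plane_graph =
  fixes G :: "('v, 'e) multigraph"
    and pos :: "'v \<Rightarrow> complex" and crv :: "'e \<Rightarrow> real \<Rightarrow> complex"
  assumes finite_graph: "finite_graph G" and plane_embedding: "plane_embedding G pos crv"
begin

section \<open>Edges and cycles as subsets of the plane\<close>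

definition trace :: "'e set \<Rightarrow> complex set" where
  "trace C = (\<Union>e\<in>C. path_image (crv e))"

definition open_edge :: "'e \<Rightarrow> complex set" where
  "open_edge e = path_image (crv e) - pos ` ends G e"

definition side :: "'e set \<Rightarrow> complex set \<Rightarrow> int" where
  "side C F = (if F \<subseteq> inside (trace C) then 1 else - 1)"

definition edge_faces :: "'e \<Rightarrow> complex set set" where
  "edge_faces e = {F \<in> faces G pos crv. e \<in> face_edges G crv F}"

lemma finite_verts: "finite (verts G)" and finite_edges: "finite (edges G)"
  using finite_graph by (auto simp: finite_graph_def)

lemma ends_subset: "e \<in> edges G \<Longrightarrow> ends G e \<subseteq> verts G"
  using finite_graph by (auto simp: finite_graph_def)

lemma inj_on_pos: "inj_on pos (verts G)"
  using plane_embedding by (simp add: plane_embedding_def)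

lemma edge_simple_path: "e \<in> edges G \<Longrightarrow> simple_path (crv e)"
  using plane_embedding by (simp add: plane_embedding_def)

lemma edge_endpoints:
  "e \<in> edges G \<Longrightarrow> pos ` ends G e = {pathstart (crv e), pathfinish (crv e)}"
  using plane_embedding by (simp add: plane_embedding_def)

lemma edge_Int_verts:
  "e \<in> edges G \<Longrightarrow> path_image (crv e) \<inter> pos ` verts G \<subseteq> pos ` ends G e"
  using plane_embedding by (simp add: plane_embedding_def)

lemma ends_subset_edge: "e \<in> edges G \<Longrightarrow> pos ` ends G e \<subseteq> path_image (crv e)"
  using edge_endpoints by auto

lemma edge_Int_edge:
  assumes "e \<in> edges G" "e' \<in> edges G" "e \<noteq> e'"
  shows "path_image (crv e) \<inter> path_image (crv e') \<subseteq> pos ` (ends G e \<inter> ends G e')"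
proof -
  have "path_image (crv e) \<inter> path_image (crv e') \<subseteq> pos ` verts G"
    using plane_embedding assms by (simp add: plane_embedding_def)
  then have "path_image (crv e) \<inter> path_image (crv e') \<subseteq> pos ` ends G e \<inter> pos ` ends G e'"
    using edge_Int_verts assms by blast
  also have "\<dots> = pos ` (ends G e \<inter> ends G e')"
    using inj_on_pos ends_subset assms by (metis inj_on_image_Int)
  finally show ?thesis .
qed

lemma open_edge_eq:
  "e \<in> edges G \<Longrightarrow> open_edge e = path_image (crv e) - {pathstart (crv e), pathfinish (crv e)}"
  by (simp add: open_edge_def edge_endpoints)

lemma connected_open_edge: "e \<in> edges G \<Longrightarrow> connected (open_edge e)"
  by (simp add: open_edge_eq connected_simple_path_endless edge_simple_path)

lemma open_edge_nonempty: "e \<in> edges G \<Longrightarrow> open_edge e \<noteq> {}"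
  by (metis open_edge_eq nonempty_simple_path_endless edge_simple_path)

text \<open>By continuity, since the closure of the open unit interval contains both parameters of
  the endpoints. Hence a closed set that contains an open edge contains the whole edge.\<close>

lemma edge_subset_closure_open_edge:
  assumes "e \<in> edges G"
  shows "path_image (crv e) \<subseteq> closure (open_edge e)"
proof -
  have "open_edge e = crv e ` {0<..<1}"
    using assms by (simp add: open_edge_eq simple_path_endless edge_simple_path)
  moreover have "crv e ` closure {0<..<1} \<subseteq> closure (crv e ` {0<..<1})"
    using edge_simple_path[OF assms]
    by (intro image_closure_subset) (auto simp: simple_path_def path_def closure_subset)
  ultimately show ?thesis
    by (simp add: path_image_def)
qed

section \<open>Orienting edges and chaining them into arcs\<close>

lemma oriented_edge:
  assumes "e \<in> edges G" "ends G e = {u, v}"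
  obtains g where "simple_path g" "pathstart g = pos u" "pathfinish g = pos v"
    "path_image g = path_image (crv e)"
proof (cases "pathstart (crv e) = pos u \<and> pathfinish (crv e) = pos v")
  case True
  then show ?thesis
    using that edge_simple_path assms by blast
next
  \<comment> \<open>The embedding fixes only the set of endpoints, so the curve may run from
    \<open>v\<close> to \<open>u\<close>; it is then reversed.\<close>
  case False
  then have "pathstart (crv e) = pos v" "pathfinish (crv e) = pos u"
    using edge_endpoints[OF assms(1)] assms(2) by (auto simp: doubleton_eq_iff)
  then show ?thesis
    using that[of "reversepath (crv e)"] edge_simple_path assms
    by (simp add: simple_path_reversepath)
qed

lemma oriented_edge_arc:
  assumes "e \<in> edges G" "ends G e = {u, v}" "u \<noteq> v"
  obtains g where "arc g" "pathstart g = pos u" "pathfinish g = pos v"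
    "path_image g = path_image (crv e)"
proof -
  have "pos u \<noteq> pos v"
    using assms ends_subset[of e] inj_on_pos by (auto dest: inj_onD)
  then show ?thesis
    using oriented_edge[OF assms(1,2)] that by (metis arc_simple_path)
qed

text \<open>Induction on \<open>k\<close>: the next edge meets each earlier one only in common end
  vertices, and as \<open>vs\<close> is distinct, only \<open>vs ! Suc k\<close> can be common. The
  bound \<open>Suc k < length es\<close> leaves out the closing edge, so no index wraps around and
  the chain does not return to its start.\<close>

lemma chain_arc:
  assumes "length vs = length es" "distinct vs" "distinct es" "set es \<subseteq> edges G"
    and "\<And>i. i < length es \<Longrightarrow> ends G (es ! i) = {vs ! i, vs ! (Suc i mod length vs)}"
    and "Suc k < length es"
  shows "\<exists>g. arc g \<and> pathstart g = pos (vs ! 0) \<and> pathfinish g = pos (vs ! Suc k) \<and>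
           path_image g = (\<Union>i\<le>k. path_image (crv (es ! i)))"
  using assms(6)
proof (induction k)
  case 0
  then have "es \<noteq> []"
    by auto
  then have "es ! 0 \<in> edges G" "ends G (es ! 0) = {vs ! 0, vs ! Suc 0}" "vs ! 0 \<noteq> vs ! Suc 0"
    using 0 assms(1,2) assms(5)[of 0] subsetD[OF assms(4) nth_mem[of 0]]
    by (auto simp: nth_eq_iff_index_eq)
  then show ?case
    by (auto elim: oriented_edge_arc)
next
  case (Suc k)
  then obtain g where g: "arc g" "pathstart g = pos (vs ! 0)" "pathfinish g = pos (vs ! Suc k)"
      "path_image g = (\<Union>i\<le>k. path_image (crv (es ! i)))"
    by auto
  have e: "es ! Suc k \<in> edges G" "ends G (es ! Suc k) = {vs ! Suc k, vs ! Suc (Suc k)}"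
      "vs ! Suc k \<noteq> vs ! Suc (Suc k)"
    using Suc.prems assms(1,2) assms(5)[of "Suc k"] subsetD[OF assms(4) nth_mem[of "Suc k"]]
    by (auto simp: nth_eq_iff_index_eq)
  then obtain h where h: "arc h" "pathstart h = pos (vs ! Suc k)"
      "pathfinish h = pos (vs ! Suc (Suc k))" "path_image h = path_image (crv (es ! Suc k))"
    by (auto elim: oriented_edge_arc)
  have "path_image (crv (es ! i)) \<inter> path_image h \<subseteq> {pos (vs ! Suc k)}" if "i \<le> k" for i
  proof -
    have "es ! i \<in> edges G" "es ! i \<noteq> es ! Suc k"
      using that Suc.prems assms(3,4) by (auto simp: nth_eq_iff_index_eq)
    then have "path_image (crv (es ! i)) \<inter> path_image h
        \<subseteq> pos ` (ends G (es ! i) \<inter> ends G (es ! Suc k))"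
      using edge_Int_edge e(1) h(4) by simp
    moreover have "ends G (es ! i) = {vs ! i, vs ! Suc i}"
      using that Suc.prems assms(1) assms(5)[of i] by simp
    moreover have "{vs ! i, vs ! Suc i} \<inter> {vs ! Suc k, vs ! Suc (Suc k)} \<subseteq> {vs ! Suc k}"
      using that Suc.prems assms(1,2) by (auto simp: nth_eq_iff_index_eq)
    ultimately show ?thesis
      using e(2) by blast
  qed
  then have "path_image g \<inter> path_image h \<subseteq> {pathstart h}"
    using g h by auto
  then have "arc (g +++ h)"
    using g h by (intro arc_join) auto
  moreover have "path_image (g +++ h) = (\<Union>i\<le>Suc k. path_image (crv (es ! i)))"
    using g h by (auto simp: path_image_join atMost_Suc)
  ultimately show ?case
    using g h by (intro exI[of _ "g +++ h"]) simp
qed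

section \<open>Cycles as Jordan curves\<close>

lemma cycle_subset: "is_cycle G C \<Longrightarrow> C \<subseteq> edges G"
  by (auto simp: is_cycle_def)

lemma finite_cycle: "is_cycle G C \<Longrightarrow> finite C"
  by (auto simp: is_cycle_def)

text \<open>Makes \<open>e\<close> the closing edge, so that the remaining edges form a chain as in
  \<open>chain_arc\<close>.\<close>

lemma cycle_ending_in_edge:
  assumes "is_cycle G C" "e \<in> C"
  obtains vs es where "length vs = length es" "distinct vs" "distinct es" "C = set es"
    "\<And>i. i < length es \<Longrightarrow> ends G (es ! i) = {vs ! i, vs ! (Suc i mod length vs)}"
    "es \<noteq> []" "last es = e"
proof -
  obtain vs es where c: "es \<noteq> []" "length vs = length es" "distinct vs" "distinct es" "C = set es"
    and ends: "\<And>i. i < length es \<Longrightarrow> ends G (es ! i) = {vs ! i, vs ! (Suc i mod length vs)}"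
    using assms(1) unfolding is_cycle_def by blast
  obtain j where j: "j < length es" "es ! j = e"
    using assms(2) c(5) by (auto simp: in_set_conv_nth)
  \<comment> \<open>Rotating by \<open>Suc j\<close> moves the entry at position \<open>j\<close> to
    the end.\<close>
  let ?vs = "rotate (Suc j) vs" and ?es = "rotate (Suc j) es"
  have "ends G (?es ! i) = {?vs ! i, ?vs ! (Suc i mod length ?vs)}" if "i < length ?es" for i
  proof -
    have "(Suc j + Suc i mod length es) mod length es = Suc ((Suc j + i) mod length es) mod length es"
      by (simp only: mod_add_right_eq mod_Suc_eq add_Suc_right)
    moreover have "Suc i mod length es < length es"
      using c(1) by simp
    ultimately show ?thesis
      using that c(2) ends[of "(Suc j + i) mod length es"] c(1)
      by (simp add: nth_rotate del: rotate_Suc)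
  qed
  moreover have "last ?es = e"
    using c(1) j by (simp add: last_conv_nth nth_rotate del: rotate_Suc)
  ultimately show ?thesis
    using c by (intro that[of ?vs ?es]) (simp_all del: rotate_Suc)
qed

text \<open>Unless \<open>e\<close> is a loop, the other edges form an arc between the ends of
  \<open>e\<close>, which \<open>e\<close> closes up. The second set includes the ends of
  \<open>e\<close> because it has to be the intersection found in \<open>cycle_Int_rest\<close>; for
  a loop it is a single point.\<close>

lemma cycle_curve:
  assumes "is_cycle G C" "e \<in> C"
  shows "\<exists>c. simple_path c \<and> pathfinish c = pathstart c \<and> path_image c = trace C"
    and "connected (pos ` ends G e \<union> trace (C - {e}))"
proof -
  obtain vs es where c: "length vs = length es" "distinct vs" "distinct es" "C = set es"
    and ends: "\<And>i. i < length es \<Longrightarrow> ends G (es ! i) = {vs ! i, vs ! (Suc i mod length vs)}"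
    and last: "es \<noteq> []" "last es = e"
    using cycle_ending_in_edge[OF assms] by metis
  have sub: "set es \<subseteq> edges G"
    using cycle_subset assms(1) c(4) by simp
  have e: "e \<in> edges G"
    using sub assms(2) c(4) by auto
  have "(\<exists>c. simple_path c \<and> pathfinish c = pathstart c \<and> path_image c = trace C) \<and>
    connected (pos ` ends G e \<union> trace (C - {e}))"
  proof (cases "length es = 1")
    \<comment> \<open>A loop is already a simple closed curve, whereas \<open>chain_arc\<close>
      needs at least two edges.\<close>
    case True
    then have "es = [e]"
      using last by (cases es) auto
    then have "C = {e}" "ends G e = {vs ! 0}"
      using c(1,4) ends[of 0] by auto
    then show ?thesis
      using edge_simple_path[OF e] edge_endpoints[OF e]
      by (auto simp: trace_def intro!: exI[of _ "crv e"])
  next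
    case False
    then obtain k where k: "length es = Suc (Suc k)"
      using last by (metis One_nat_def length_0_conv nat.exhaust)
    obtain g where g: "arc g" "pathstart g = pos (vs ! 0)" "pathfinish g = pos (vs ! Suc k)"
      "path_image g = (\<Union>i\<le>k. path_image (crv (es ! i)))"
      using chain_arc[OF c(1-3) sub ends] k by auto
    have ek: "es ! Suc k = e"
      using last k by (simp add: last_conv_nth)
    have e_ends: "ends G e = {vs ! Suc k, vs ! 0}"
      using ends[of "Suc k"] k c(1) ek by simp
    have "vs ! Suc k \<noteq> vs ! 0"
      using c k by (simp add: nth_eq_iff_index_eq)
    then obtain h where h: "arc h" "pathstart h = pos (vs ! Suc k)" "pathfinish h = pos (vs ! 0)"
        "path_image h = path_image (crv e)"
      using oriented_edge_arc[OF e e_ends] by blast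
    have "C = (!) es ` {..Suc k}"
      using c(4) k by (auto simp: set_conv_nth less_Suc_eq_le)
    moreover have "e \<notin> (!) es ` {..k}"
      using c(3) k ek by (auto simp: nth_eq_iff_index_eq)
    ultimately have C: "C - {e} = (!) es ` {..k}" "C = insert e ((!) es ` {..k})"
      using ek by (auto simp: atMost_Suc)
    have g_trace: "path_image g = trace (C - {e})"
      unfolding trace_def C(1) g(4) by simp
    \<comment> \<open>Distinct edges meet only in common ends, so the arc \<open>g\<close> through
      the other edges and the arc \<open>h\<close> along \<open>e\<close> share only their
      endpoints.\<close>
    have "path_image (crv e') \<inter> path_image h \<subseteq> pos ` ends G e" if "e' \<in> C - {e}" for e'
      using edge_Int_edge[of e' e] that sub c(4) e h(4) by auto
    then have "path_image g \<inter> path_image h \<subseteq> {pathstart g, pathstart h}"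
      unfolding g_trace trace_def using g h e_ends by auto
    then have "simple_path (g +++ h)"
      using g h by (intro simple_path_join_loop) auto
    moreover have "path_image (g +++ h) = trace C"
      using g h g_trace assms(2) by (auto simp: path_image_join trace_def)
    moreover have "pos ` ends G e \<subseteq> path_image g"
      using e_ends g(2,3) pathstart_in_path_image[of g] pathfinish_in_path_image[of g] by auto
    then have "connected (pos ` ends G e \<union> trace (C - {e}))"
      using g_trace g(1) by (metis Un_absorb1 connected_arc_image)
    ultimately show ?thesis
      using g h by (intro conjI exI[of _ "g +++ h"]) auto
  qed
  then show "\<exists>c. simple_path c \<and> pathfinish c = pathstart c \<and> path_image c = trace C"
    and "connected (pos ` ends G e \<union> trace (C - {e}))"
    by auto
qed

text \<open>The Jordan curve theorem, phrased with \<open>components\<close> so that connected sets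
  off the cycle can be placed by maximality.\<close>

lemma Jordan_cycle:
  assumes "is_cycle G C"
  shows "inside (trace C) \<in> components (- trace C)" "outside (trace C) \<in> components (- trace C)"
    "frontier (inside (trace C)) = trace C" "frontier (outside (trace C)) = trace C"
proof -
  obtain e where "e \<in> C"
    using assms by (fastforce simp: is_cycle_def)
  then obtain c where "simple_path c" "pathfinish c = pathstart c" "path_image c = trace C"
    using cycle_curve(1) assms by blast
  then have J: "inside (trace C) \<noteq> {}" "connected (inside (trace C))"
    "outside (trace C) \<noteq> {}" "connected (outside (trace C))" "compact (trace C)"
    "frontier (inside (trace C)) = trace C" "frontier (outside (trace C)) = trace C"
    using Jordan_inside_outside[of c] compact_simple_path_image[of c] by auto
  then show "inside (trace C) \<in> components (- trace C)" "outside (trace C) \<in> components (- trace C)"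
    by (auto simp: inside_in_components outside_in_components compact_imp_bounded compact_imp_closed)
  show "frontier (inside (trace C)) = trace C" "frontier (outside (trace C)) = trace C"
    by fact+
qed

section \<open>Faces and their position relative to a cycle\<close>

lemma compact_trace:
  assumes "C \<subseteq> edges G"
  shows "compact (trace C)"
  unfolding trace_def using assms finite_subset[OF assms finite_edges]
  by (intro compact_UN) (auto intro: compact_simple_path_image edge_simple_path)

lemma drawing_eq: "drawing G pos crv = pos ` verts G \<union> trace (edges G)"
  by (simp add: drawing_def trace_def)

lemma compact_drawing: "compact (drawing G pos crv)"
  unfolding drawing_eq using finite_verts
  by (intro compact_Un compact_trace) (auto intro: finite_imp_compact)

lemma open_face: "F \<in> faces G pos crv \<Longrightarrow> open F"
  unfolding faces_def using compact_drawing compact_imp_closed open_components by blast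

lemma face_connected: "F \<in> faces G pos crv \<Longrightarrow> connected F"
  unfolding faces_def by (rule in_components_connected)

lemma face_nonempty: "F \<in> faces G pos crv \<Longrightarrow> F \<noteq> {}"
  unfolding faces_def by (rule in_components_nonempty)

lemma face_subset: "F \<in> faces G pos crv \<Longrightarrow> F \<subseteq> - drawing G pos crv"
  unfolding faces_def by (rule in_components_subset)

lemma face_Int_trace:
  assumes "F \<in> faces G pos crv" "C \<subseteq> edges G"
  shows "F \<subseteq> - trace C"
proof -
  have "trace C \<subseteq> drawing G pos crv"
    using assms(2) by (auto simp: drawing_eq trace_def)
  then show ?thesis
    using face_subset[OF assms(1)] by blast
qed

lemma face_sides:
  assumes "F \<in> faces G pos crv" "is_cycle G C"
  shows "F \<subseteq> inside (trace C) \<or> F \<subseteq> outside (trace C)"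
proof -
  have F: "F \<noteq> {}" "connected F" "F \<subseteq> - trace C"
    using assms face_nonempty face_connected face_Int_trace cycle_subset by auto
  then have "F \<inter> inside (trace C) \<noteq> {} \<or> F \<inter> outside (trace C) \<noteq> {}"
    using inside_Un_outside[of "trace C"] by blast
  then show ?thesis
    using F Jordan_cycle(1,2)[OF assms(2)] components_maximal by (metis inf_commute)
qed

section \<open>The faces bordering an edge\<close>

text \<open>Computes the intersection that Janiszewski's theorem asks to be connected. A point of
  \<open>e\<close> other than its ends is no vertex and lies on no other edge.\<close>

lemma cycle_Int_rest:
  assumes "is_cycle G C" "e \<in> C"
  shows "trace C \<inter> (pos ` verts G \<union> trace (edges G - {e})) = pos ` ends G e \<union> trace (C - {e})"
    (is "?L = ?R")
proof
  have C: "C \<subseteq> edges G" "e \<in> edges G"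
    using assms cycle_subset by auto
  show "?R \<subseteq> ?L"
    using C assms(2) ends_subset[of e] ends_subset_edge[of e] by (fastforce simp: trace_def)
  show "?L \<subseteq> ?R"
  proof
    fix x assume x: "x \<in> ?L"
    show "x \<in> ?R"
    proof (cases "x \<in> path_image (crv e)")
      case True
      have "x \<in> pos ` ends G e" if "e' \<in> edges G - {e}" "x \<in> path_image (crv e')" for e'
        using edge_Int_edge[of e e'] that True C by auto
      then show ?thesis
        using x True edge_Int_verts[OF C(2)] by (auto simp: trace_def)
    qed (use x in \<open>auto simp: trace_def\<close>)
  qed
qed

lemma open_edge_subset:
  assumes "e \<in> edges G"
  shows "open_edge e \<subseteq> - (pos ` verts G \<union> trace (edges G - {e}))"
  using edge_Int_verts[OF assms] edge_Int_edge[OF assms]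
  by (fastforce simp: open_edge_def trace_def)

text \<open>\<open>R\<close> stands for the inside or the outside of the cycle. Near the open edge,
  all points of \<open>R\<close> belong to one face; this face borders \<open>e\<close>, and any
  face in \<open>R\<close> that borders \<open>e\<close> must meet it.\<close>

lemma ex1_edge_face:
  assumes "is_cycle G C" "e \<in> C" and R: "R \<in> components (- trace C)" "frontier R = trace C"
  shows "\<exists>F. {F \<in> edge_faces e. F \<subseteq> R} = {F}"
proof -
  define D T where "D = drawing G pos crv" and "T = pos ` verts G \<union> trace (edges G - {e})"
  have C: "C \<subseteq> edges G" "e \<in> edges G"
    using assms cycle_subset by auto
  have D: "D = trace C \<union> T"
    using C assms(2) by (auto simp: D_def T_def drawing_eq trace_def)
  have closed_T: "closed T"
    unfolding T_def using finite_verts compact_trace[of "edges G - {e}"]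
    by (auto intro: compact_imp_closed finite_imp_closed)
  obtain p where p: "p \<in> open_edge e"
    using open_edge_nonempty C by auto
  \<comment> \<open>\<open>W\<close> is an open neighbourhood of the open edge that avoids the rest
    of the drawing.\<close>
  define W where "W = connected_component_set (- T) p"
  have W: "open W" "connected W" "W \<subseteq> - T"
    using closed_T by (auto simp: W_def open_Compl open_connected_component connected_component_subset)
  have edge_W: "open_edge e \<subseteq> W"
    unfolding W_def
    using p connected_open_edge[OF C(2)] open_edge_subset[OF C(2), folded T_def]
    by (rule connected_component_maximal)
  \<comment> \<open>As \<open>e\<close> lies on the frontier of \<open>R\<close> and
    \<open>W\<close> is open, each point of the open edge is a limit of points of
    \<open>W \<inter> R\<close>.\<close>
  have "path_image (crv e) \<subseteq> closure R"
    using R(2) assms(2) by (auto simp: trace_def frontier_def)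
  then have "open_edge e \<subseteq> W \<inter> closure R"
    using edge_W by (auto simp: open_edge_def)
  then have edge_WR: "open_edge e \<subseteq> closure (W \<inter> R)"
    using open_Int_closure_subset[OF W(1)] by blast
  then obtain a where a: "a \<in> W \<inter> R"
    using p by (metis all_not_in_conv closure_empty subsetD)
  have R_sub: "R \<subseteq> - trace C" "connected R"
    using R(1) in_components_subset in_components_connected by auto
  have WR_D: "W \<inter> R \<subseteq> - D"
    using W(3) R_sub(1) D by auto
  define F where "F = connected_component_set (- D) a"
  have F: "F \<in> faces G pos crv"
    using a WR_D by (auto simp: F_def faces_def D_def componentsI)
  \<comment> \<open>Two points of \<open>W \<inter> R\<close> are connected within \<open>R\<close>,
    hence off the cycle, and within \<open>W\<close>, hence off \<open>T\<close>. By Janiszewski's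
    theorem they are connected off both at once, so they lie in the same face.\<close>
  have WR_F: "W \<inter> R \<subseteq> F"
  proof
    fix b assume b: "b \<in> W \<inter> R"
    have "connected (trace C \<inter> T)"
      unfolding T_def cycle_Int_rest[OF assms(1,2)] by (rule cycle_curve(2)[OF assms(1,2)])
    moreover have "connected_component (- trace C) a b"
      using a b R_sub unfolding connected_component_def by blast
    moreover have "connected_component (- T) a b"
      using a b W unfolding connected_component_def by blast
    ultimately have "connected_component (- (trace C \<union> T)) a b"
      using compact_trace[OF C(1)] closed_T by (intro Janiszewski)
    then show "b \<in> F"
      by (simp add: F_def D)
  qed
  have "a \<in> R \<inter> F"
    using a WR_F by auto
  then have "F \<subseteq> R"
    using components_maximal[OF R(1)] F face_connected face_Int_trace[OF F C(1)] by blast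
  moreover have "F \<in> edge_faces e"
  proof -
    have "open_edge e \<subseteq> closure F"
      using edge_WR closure_mono[OF WR_F] by blast
    then have "path_image (crv e) \<subseteq> closure F"
      using edge_subset_closure_open_edge[OF C(2)] closure_minimal by blast
    moreover have "path_image (crv e) \<inter> F = {}"
      using face_subset[OF F] C(2) by (auto simp: drawing_def)
    ultimately show ?thesis
      using C(2) F open_face[OF F]
      by (auto simp: edge_faces_def face_edges_def frontier_def interior_open)
  qed
  \<comment> \<open>\<open>W\<close> is a neighbourhood of \<open>p\<close>, a limit point of
    \<open>F'\<close>, so \<open>F'\<close> meets \<open>W \<inter> R\<close> and thus
    \<open>F\<close>.\<close>
  moreover have "F' = F" if F': "F' \<in> edge_faces e" "F' \<subseteq> R" for F'
  proof -
    have "p \<in> closure F'"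
      using F'(1) p by (auto simp: edge_faces_def face_edges_def frontier_def open_edge_def)
    then have "W \<inter> F' \<noteq> {}"
      using W(1) p edge_W open_Int_closure_eq_empty by blast
    then have "F \<inter> F' \<noteq> {}"
      using F'(2) WR_F by blast
    then show ?thesis
      using F F'(1) components_nonoverlap by (fastforce simp: edge_faces_def faces_def)
  qed
  ultimately show ?thesis
    by (intro exI[of _ F]) blast
qed

lemma edge_faces_cycle:
  assumes "is_cycle G C" "e \<in> C"
  obtains A B where "edge_faces e = {A, B}" "A \<noteq> B" "side C A = 1" "side C B = - 1"
proof -
  obtain A where A: "{F \<in> edge_faces e. F \<subseteq> inside (trace C)} = {A}"
    using ex1_edge_face[OF assms Jordan_cycle(1,3)[OF assms(1)]] by (rule exE)
  obtain B where B: "{F \<in> edge_faces e. F \<subseteq> outside (trace C)} = {B}"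
    using ex1_edge_face[OF assms Jordan_cycle(2,4)[OF assms(1)]] by (rule exE)
  have "edge_faces e = {F \<in> edge_faces e. F \<subseteq> inside (trace C)} \<union>
      {F \<in> edge_faces e. F \<subseteq> outside (trace C)}"
    using face_sides assms(1) by (auto simp: edge_faces_def)
  then have "edge_faces e = {A, B}"
    unfolding A B by auto
  moreover have "A \<subseteq> inside (trace C)" "B \<subseteq> outside (trace C)" "B \<in> edge_faces e"
    using A B by blast+
  \<comment> \<open>\<open>side\<close> tests only for the inside, so the value at \<open>B\<close>
    needs that the nonempty face \<open>B\<close> is not inside.\<close>
  moreover from this have "\<not> B \<subseteq> inside (trace C)"
    using inside_Int_outside[of "trace C"] face_nonempty[of B] unfolding edge_faces_def by blast
  ultimately show ?thesis
    using that[of A B] by (auto simp: side_def)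
qed

lemma finite_edge_faces:
  assumes "is_cycle G C" "e \<in> C"
  shows "finite (edge_faces e)"
  using edge_faces_cycle[OF assms] by (metis finite.emptyI finite_insert)

text \<open>A point \<open>p\<close> of the open edge lies off the cycle, in an open component
  \<open>S\<close> of its complement. Every face bordering \<open>e\<close> has \<open>p\<close> in
  its closure, so it meets \<open>S\<close> and, being connected, stays in \<open>S\<close>.\<close>

lemma side_eq_of_notin_cycle:
  assumes "is_cycle G C" "e \<in> edges G" "e \<notin> C" and AB: "A \<in> edge_faces e" "B \<in> edge_faces e"
  shows "side C A = side C B"
proof -
  have C: "C \<subseteq> edges G"
    using assms cycle_subset by auto
  obtain p where p: "p \<in> open_edge e"
    using open_edge_nonempty assms(2) by auto
  then have "p \<in> - trace C"
    using open_edge_subset[OF assms(2)] assms(3) C by (force simp: trace_def)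
  then have "p \<in> inside (trace C) \<union> outside (trace C)"
    unfolding inside_Un_outside .
  then obtain S where S: "p \<in> S" "S = inside (trace C) \<or> S = outside (trace C)"
      "S \<in> components (- trace C)"
    using Jordan_cycle(1,2)[OF assms(1)] by (metis UnE)
  then have "open S"
    using compact_trace[OF C] compact_imp_closed open_components by blast
  have "F \<subseteq> S" if "F \<in> edge_faces e" for F
  proof -
    have F: "F \<in> faces G pos crv" "p \<in> closure F"
      using that p by (auto simp: edge_faces_def face_edges_def frontier_def open_edge_def)
    then have "S \<inter> F \<noteq> {}"
      using \<open>open S\<close> S(1) open_Int_closure_eq_empty by blast
    then show ?thesis
      using components_maximal[OF S(3)] face_connected[OF F(1)] face_Int_trace[OF F(1) C] by blast
  qed
  then have "A \<subseteq> S" "B \<subseteq> S"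
    using AB by blast+
  moreover have "A \<noteq> {}" "B \<noteq> {}"
    using AB face_nonempty[of A] face_nonempty[of B] by (simp_all add: edge_faces_def)
  ultimately show ?thesis
    using S(2) inside_Int_outside[of "trace C"]
    unfolding side_def by (smt (verit) le_inf_iff subset_empty)
qed

section \<open>Counting signed incidences of faces and edges\<close>

lemma sum_edge_faces_eq_0:
  assumes "is_cycle G C" "is_cycle G C'" "e \<in> C" "e \<notin> C'"
  shows "(\<Sum>F\<in>edge_faces e. side C F * side C' F) = 0"
proof -
  obtain A B where AB: "edge_faces e = {A, B}" "A \<noteq> B" "side C A = 1" "side C B = - 1"
    using edge_faces_cycle assms(1,3) by blast
  have "side C' A = side C' B"
    using assms AB(1) cycle_subset by (intro side_eq_of_notin_cycle[of C' e]) auto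
  then show ?thesis
    using AB by simp
qed

text \<open>Double counting of the incidences between faces in \<open>\<F>\<close> and edges of
  \<open>C\<close>. The right-hand side is symmetric in \<open>C\<close> and \<open>C'\<close>,
  which is what allows the comparison of the two cycles.\<close>

lemma sum_signature_eq:
  assumes "is_cycle G C" "is_cycle G C'" "finite \<F>" "\<F> \<subseteq> faces G pos crv"
    and "\<And>e. e \<in> C \<Longrightarrow> edge_faces e \<subseteq> \<F>"
  shows "(\<Sum>F\<in>\<F>. side C F * side C' F * int (card (face_edges G crv F \<inter> C))) =
    (\<Sum>e\<in>C \<inter> C'. \<Sum>F\<in>edge_faces e. side C F * side C' F)"
proof -
  have fin: "finite C"
    using finite_cycle assms(1) .
  have "(\<Sum>F\<in>\<F>. side C F * side C' F * int (card (face_edges G crv F \<inter> C))) =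
      (\<Sum>F\<in>\<F>. \<Sum>e | e \<in> C \<and> e \<in> face_edges G crv F. side C F * side C' F)"
    by (intro sum.cong) (auto simp: Int_def conj_commute mult.commute)
  also have "\<dots> = (\<Sum>e\<in>C. \<Sum>F | F \<in> \<F> \<and> e \<in> face_edges G crv F. side C F * side C' F)"
    using assms(3) fin by (rule sum.swap_restrict)
  also have "\<dots> = (\<Sum>e\<in>C. \<Sum>F\<in>edge_faces e. side C F * side C' F)"
  proof (rule sum.cong[OF refl])
    fix e assume "e \<in> C"
    then have "{F \<in> \<F>. e \<in> face_edges G crv F} = edge_faces e"
      using assms(4) assms(5)[of e] by (auto simp: edge_faces_def)
    then show "(\<Sum>F | F \<in> \<F> \<and> e \<in> face_edges G crv F. side C F * side C' F) =
        (\<Sum>F\<in>edge_faces e. side C F * side C' F)"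
      by simp
  qed
  \<comment> \<open>Edges of \<open>C\<close> outside \<open>C'\<close> drop out by
    \<open>sum_edge_faces_eq_0\<close>.\<close>
  also have "\<dots> = (\<Sum>e\<in>C \<inter> C'. \<Sum>F\<in>edge_faces e. side C F * side C' F)"
    using fin sum_edge_faces_eq_0 assms(1,2) by (intro sum.mono_neutral_right) auto
  finally show ?thesis .
qed

end

section \<open>Comparison of the two cycles at the exterior face\<close>

theorem corollary1:
  fixes G :: "('v, 'e) multigraph"
    and pos :: "'v \<Rightarrow> complex" and crv :: "'e \<Rightarrow> real \<Rightarrow> complex"
    and C\<^sub>1 C\<^sub>2 :: "'e set"
  assumes "finite_graph G" and "connected_graph G" and "bridgeless G"
    and "plane_embedding G pos crv"
    and "is_cycle G C\<^sub>1" and "is_cycle G C\<^sub>2"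
    and "signature G pos crv C\<^sub>1 = signature G pos crv C\<^sub>2"
  shows "card (face_edges G crv (exterior_face G pos crv) \<inter> C\<^sub>1) =
         card (face_edges G crv (exterior_face G pos crv) \<inter> C\<^sub>2)"
proof -
  interpret plane_graph G pos crv
    using assms by unfold_locales
  define X where "X = exterior_face G pos crv"
  have ex1: "\<exists>!F. F \<in> faces G pos crv \<and> \<not> bounded F"
    using assms ex1_exterior_face by blast
  then have X: "X \<in> faces G pos crv"
    unfolding X_def exterior_face_def by (metis (mono_tags, lifting) theI')
  have bounded: "bounded F" if "F \<in> faces G pos crv" "F \<noteq> X" for F
    using that ex1 theI'[OF ex1] unfolding X_def exterior_face_def by blast
  \<comment> \<open>Only faces bordering an edge of either cycle matter, together with
    \<open>X\<close>. This family is finite because each such edge borders just two faces.\<close>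
  define \<F> where "\<F> = insert X (\<Union>e\<in>C\<^sub>1 \<union> C\<^sub>2. edge_faces e)"
  have \<F>: "finite \<F>" "\<F> \<subseteq> faces G pos crv" "X \<in> \<F>"
    using X finite_cycle finite_edge_faces assms(5,6) by (auto simp: \<F>_def edge_faces_def)
  define s where "s F = side C\<^sub>1 F * side C\<^sub>2 F" for F
  define n where "n C F = int (card (face_edges G crv F \<inter> C))" for C F
  have "(\<Sum>F\<in>\<F>. s F * n C\<^sub>1 F) = (\<Sum>e\<in>C\<^sub>1 \<inter> C\<^sub>2. \<Sum>F\<in>edge_faces e. s F)"
    using sum_signature_eq[OF assms(5,6) \<F>(1,2)] by (auto simp: \<F>_def s_def n_def)
  \<comment> \<open>The same count with the cycles exchanged; \<open>s\<close> and the right-hand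
    side are unchanged.\<close>
  moreover have "(\<Sum>F\<in>\<F>. s F * n C\<^sub>2 F) = (\<Sum>e\<in>C\<^sub>1 \<inter> C\<^sub>2. \<Sum>F\<in>edge_faces e. s F)"
    using sum_signature_eq[OF assms(6,5) \<F>(1,2)]
    by (auto simp: \<F>_def s_def n_def mult.commute Int_commute)
  ultimately have "(\<Sum>F\<in>\<F>. s F * n C\<^sub>1 F) = (\<Sum>F\<in>\<F>. s F * n C\<^sub>2 F)"
    by simp
  \<comment> \<open>Faces other than \<open>X\<close> are bounded, so the equal signatures apply to
    them.\<close>
  moreover have "n C\<^sub>1 F = n C\<^sub>2 F" if "F \<in> \<F> - {X}" for F
  proof -
    have "F \<in> finite_faces G pos crv"
      using that bounded \<F>(2) by (auto simp: finite_faces_def)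
    then show ?thesis
      using fun_cong[OF assms(7), of F] by (simp add: signature_def n_def)
  qed
  then have "(\<Sum>F\<in>\<F> - {X}. s F * n C\<^sub>1 F) = (\<Sum>F\<in>\<F> - {X}. s F * n C\<^sub>2 F)"
    by (intro sum.cong) auto
  ultimately have "s X * n C\<^sub>1 X = s X * n C\<^sub>2 X"
    using \<F> by (simp add: sum.remove[of \<F> X])
  moreover have "s X \<noteq> 0"
    by (simp add: s_def side_def)
  ultimately show ?thesis
    by (simp add: n_def X_def)
qed

end
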